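(* Let $N\ge 1$, $p>1$ and $q>\frac{2p}{p+1}$. There exists a constant $c_{N,p,q}>0$, depending only on $N,p,q$, such that for every $M>0$, every domain $\Omega\subset\mathbb{R}^N$ and every positive solution $u$ of $$-\Delta u=|u|^{p-1}u+M|\nabla u|^q\quad\text{in }\Omega,$$ there holds $$|\nabla u(x)|\le c_{N,p,q}\left(M^{-\frac{p+1}{(p+1)q-2p}}+\big(M\,\mathrm{dist}(x,\partial\Omega)\big)^{-\frac{1}{q-1}}\right)\qquad\text{for all }x\in\Omega .$$ As a consequence, any ground state $u$ (positive solution of the equation in $\mathbb{R}^N$) has at most linear growth at infinity: $$|\nabla u(x)|\le c_{N,p,q}\,M^{-\frac{p+1}{(p+1)q-2p}}\qquad\text{for all }x\in\mathbb{R}^N .$$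
   Context: Solutions are classical ($C^2$). A domain is a connected open set. In the first estimate $\partial\Omega\neq\emptyset$; the case $\Omega=\mathbb{R}^N$ is the second estimate. *)

theory Defs
  imports "HOL-Analysis.Analysis" "HOL-Library.Landau_Symbols"
begin

text \<open>
  Partial derivatives are read off the Frechet derivative, so their value is only meaningful
  where the function is differentiable. Below they are used only for functions satisfying
  \<open>C2_on\<close> on an open set, which guarantees this.
\<close>

definition partial_deriv :: "'n \<Rightarrow> (real ^ 'n \<Rightarrow> real) \<Rightarrow> real ^ 'n \<Rightarrow> real" where
  "partial_deriv i u x = frechet_derivative u (at x) (axis i 1)"

definition gradient :: "(real ^ 'n \<Rightarrow> real) \<Rightarrow> real ^ 'n \<Rightarrow> real ^ 'n" where
  "gradient u x = (\<chi> i. partial_deriv i u x)"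

definition laplacian :: "(real ^ 'n \<Rightarrow> real) \<Rightarrow> real ^ 'n \<Rightarrow> real" where
  "laplacian u x = (\<Sum>i\<in>UNIV. partial_deriv i (partial_deriv i u) x)"

definition C1_on :: "(real ^ 'n) set \<Rightarrow> (real ^ 'n \<Rightarrow> real) \<Rightarrow> bool" where
  "C1_on \<Omega> u \<longleftrightarrow>
     (\<forall>x\<in>\<Omega>. u differentiable (at x)) \<and> (\<forall>i. continuous_on \<Omega> (partial_deriv i u))"

definition C2_on :: "(real ^ 'n) set \<Rightarrow> (real ^ 'n \<Rightarrow> real) \<Rightarrow> bool" where
  "C2_on \<Omega> u \<longleftrightarrow> C1_on \<Omega> u \<and> (\<forall>i. C1_on \<Omega> (partial_deriv i u))"

definition is_domain :: "'a::topological_space set \<Rightarrow> bool" where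
  "is_domain \<Omega> \<longleftrightarrow> open \<Omega> \<and> connected \<Omega>"

text \<open>
  A solution on \<open>\<Omega>\<close> is represented by a total function whose values outside \<open>\<Omega>\<close> are irrelevant.
  At zeros of the gradient, \<open>0 powr q = 0\<close> is the intended value, since \<open>q > 0\<close>.
\<close>

definition positive_solution ::
    "real \<Rightarrow> real \<Rightarrow> real \<Rightarrow> (real ^ 'n) set \<Rightarrow> (real ^ 'n \<Rightarrow> real) \<Rightarrow> bool" where
  "positive_solution p q M \<Omega> u \<longleftrightarrow>
     C2_on \<Omega> u \<and>
     (\<forall>x\<in>\<Omega>. u x > 0) \<and>
     (\<forall>x\<in>\<Omega>. - laplacian u x =
        \<bar>u x\<bar> powr (p - 1) * u x + M * norm (gradient u x) powr q)"

definition ground_state ::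
    "real \<Rightarrow> real \<Rightarrow> real \<Rightarrow> (real ^ 'n \<Rightarrow> real) \<Rightarrow> bool" where
  "ground_state p q M u \<longleftrightarrow> positive_solution p q M UNIV u"

end

theory Submission
  imports Defs
begin

text \<open>
  Bernstein's method for \<open>z = |\<nabla>u|\<^sup>2\<close>. Formally
  \<open>\<Delta>z / 2 = |D\<^sup>2u|\<^sup>2 - \<nabla>u \<bullet> \<nabla>(u\<^sup>p + M z\<^bsup>q/2\<^esup>)\<close> and \<open>N |D\<^sup>2u|\<^sup>2 \<ge> (\<Delta>u)\<^sup>2 \<ge> u\<^bsup>2p\<^esup> + M\<^sup>2 z\<^sup>q\<close>. The bad term
  \<open>p u\<^bsup>p-1\<^esup> z\<close> is absorbed by \<open>u\<^bsup>2p\<^esup>\<close> up to a multiple of \<open>z\<^bsup>2p/(p+1)\<^esup>\<close>, which is dominated by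
  \<open>M\<^sup>2 z\<^sup>q\<close> for large \<open>z\<close> since \<open>q > 2p/(p+1)\<close>. Hence \<open>z\<close> cannot touch from below the
  supersolution \<open>A + B (R\<^sup>2 - |x - x0|\<^sup>2)\<^bsup>-2/(q-1)\<^esup>\<close>, which blows up on the boundary of a ball.

  Since \<open>u\<close> is only \<open>C\<^sup>2\<close>, \<open>z\<close> is only \<open>C\<^sup>1\<close>. The second-derivative test is therefore applied to the
  \<open>C\<^sup>2\<close> function obtained from \<open>z\<close> by replacing \<open>\<nabla>u\<close> by difference quotients of step \<open>h\<close>.
  Difference quotients commute with the Laplacian, so the equation (whose right-hand side is
  \<open>C\<^sup>1\<close> where \<open>\<nabla>u \<noteq> 0\<close>) allows passing to the limit \<open>h \<rightarrow> 0\<close> along a sequence of maximum points.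
\<close>

section \<open>Derivatives along coordinate lines and the gradient\<close>

lemma has_line_derivative:
  fixes u :: "real ^ 'n \<Rightarrow> real"
  assumes "u differentiable (at (x + t *\<^sub>R axis i 1))"
  shows "((\<lambda>t. u (x + t *\<^sub>R axis i 1)) has_real_derivative
            partial_deriv i u (x + t *\<^sub>R axis i 1)) (at t)"
proof -
  let ?D = "frechet_derivative u (at (x + t *\<^sub>R axis i 1))"
  have u: "(u has_derivative ?D) (at (x + t *\<^sub>R axis i 1))"
    using assms frechet_derivative_works by blast
  have "((\<lambda>t. x + t *\<^sub>R axis i 1) has_derivative (\<lambda>s. s *\<^sub>R axis i (1::real))) (at t)"
    by (auto intro!: derivative_eq_intros)
  from has_derivative_compose[OF this u]
  have "((\<lambda>t. u (x + t *\<^sub>R axis i 1)) has_derivative (\<lambda>s. ?D (s *\<^sub>R axis i 1))) (at t)" .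
  moreover have "?D (s *\<^sub>R axis i 1) = partial_deriv i u (x + t *\<^sub>R axis i 1) * s" for s
    using linear_frechet_derivative[OF assms] by (simp add: partial_deriv_def linear_cmul)
  ultimately show ?thesis by (simp add: has_field_derivative_def)
qed

lemma frechet_derivative_eq_gradient:
  fixes u :: "real ^ 'n \<Rightarrow> real"
  assumes "u differentiable (at x)"
  shows "frechet_derivative u (at x) h = gradient u x \<bullet> h"
proof -
  have lin: "linear (frechet_derivative u (at x))"
    using linear_frechet_derivative[OF assms] .
  have "frechet_derivative u (at x) h = frechet_derivative u (at x) (\<Sum>i\<in>UNIV. h $ i *\<^sub>R axis i 1)"
    by (simp add: basis_expansion flip: scalar_mult_eq_scaleR)
  also have "\<dots> = (\<Sum>i\<in>UNIV. h $ i * partial_deriv i u x)"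
    using lin by (simp add: linear_sum linear_cmul partial_deriv_def)
  finally show ?thesis
    by (simp add: inner_vec_def gradient_def mult.commute)
qed

lemma norm_gradient_sq: "(norm (gradient u x))\<^sup>2 = (\<Sum>i\<in>UNIV. (partial_deriv i u x)\<^sup>2)"
  by (simp add: norm_vec_def L2_set_def gradient_def sum_nonneg)

lemma C2_onD:
  assumes "C2_on \<Omega> u"
  shows "x \<in> \<Omega> \<Longrightarrow> u differentiable (at x)"
    and "x \<in> \<Omega> \<Longrightarrow> partial_deriv i u differentiable (at x)"
    and "continuous_on \<Omega> (partial_deriv i u)"
    and "continuous_on \<Omega> (partial_deriv j (partial_deriv i u))"
  using assms unfolding C2_on_def C1_on_def by auto

section \<open>Difference quotients and the second-derivative test\<close>

definition diff_quot :: "real \<Rightarrow> 'n \<Rightarrow> (real ^ 'n \<Rightarrow> real) \<Rightarrow> real ^ 'n \<Rightarrow> real" where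
  "diff_quot h j f x = (f (x + h *\<^sub>R axis j 1) - f x) / h"

text \<open>The base points move with \<open>n\<close>, so a derivative at \<open>x\<close> alone
  would not give the limit. The mean value theorem turns the quotient at \<open>X n\<close> into
  \<open>g\<close> at an intermediate point, and continuity of \<open>g\<close> at \<open>x\<close>
  finishes. The hypothesis is phrased along lines in direction \<open>j\<close>, the form in which
  the derivative of \<open>laplacian u\<close> is available.\<close>

lemma diff_quot_tendsto:
  fixes f :: "real ^ 'n \<Rightarrow> real"
  assumes S: "open S" "x \<in> S"
    and f: "\<And>y. y \<in> S \<Longrightarrow> ((\<lambda>t. f (y + t *\<^sub>R axis j 1)) has_real_derivative g y) (at 0)"
    and g: "isCont g x"
    and X: "X \<longlonglongrightarrow> x" and h: "h \<longlonglongrightarrow> 0" "\<And>n. h n > 0"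
  shows "(\<lambda>n. diff_quot (h n) j f (X n)) \<longlonglongrightarrow> g x"
proof (rule tendstoI)
  fix e :: real assume e: "e > 0"
  obtain d1 where d1: "d1 > 0" "\<And>y. dist y x < d1 \<Longrightarrow> dist (g y) (g x) < e"
    using g e unfolding continuous_at_eps_delta by blast
  obtain d2 where d2: "d2 > 0" "ball x d2 \<subseteq> S"
    using S open_contains_ball by blast
  define d where "d = min d1 d2"
  have d: "d > 0" using d1 d2 by (simp add: d_def)
  have "(\<lambda>n. dist (X n) x + h n) \<longlonglongrightarrow> 0 + 0"
    using X h by (intro tendsto_add) (simp_all flip: tendsto_dist_iff)
  then have "\<forall>\<^sub>F n in sequentially. dist (X n) x + h n < d"
    using d order_tendstoD(2) by fastforce
  then show "\<forall>\<^sub>F n in sequentially. dist (diff_quot (h n) j f (X n)) (g x) < e"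
  proof eventually_elim
    case (elim n)
    have near: "dist (X n + t *\<^sub>R axis j 1) x < d" if "0 \<le> t" "t \<le> h n" for t
    proof -
      have "dist (X n + t *\<^sub>R axis j 1) x \<le> dist (X n + t *\<^sub>R axis j 1) (X n) + dist (X n) x"
        by (rule dist_triangle)
      also have "dist (X n + t *\<^sub>R axis j (1::real)) (X n) = t"
        using that by (simp add: dist_norm norm_axis_1)
      finally show ?thesis using elim that by linarith
    qed
    have der: "((\<lambda>t. f (X n + t *\<^sub>R axis j 1)) has_real_derivative g (X n + t *\<^sub>R axis j 1)) (at t)"
      if "0 \<le> t" "t \<le> h n" for t
    proof -
      have "X n + t *\<^sub>R axis j 1 \<in> S"
        using near[OF that] d2 by (auto simp: d_def dist_commute)
      from f[OF this]
      have "((\<lambda>s. f (X n + (t + s) *\<^sub>R axis j 1)) has_real_derivative g (X n + t *\<^sub>R axis j 1)) (at 0)"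
        by (simp only: scaleR_add_left add.assoc)
      then show ?thesis
        using DERIV_shift[of "\<lambda>t. f (X n + t *\<^sub>R axis j 1)" _ 0 t] by (simp add: add.commute)
    qed
    have "\<exists>s>0. s < h n \<and> f (X n + h n *\<^sub>R axis j 1) - f (X n + 0 *\<^sub>R axis j 1)
        = (h n - 0) * g (X n + s *\<^sub>R axis j 1)"
      by (rule MVT2[OF h(2)[of n], of "\<lambda>t. f (X n + t *\<^sub>R axis j 1)"]) (rule der)
    then obtain s where s: "0 < s" "s < h n"
      "f (X n + h n *\<^sub>R axis j 1) - f (X n) = h n * g (X n + s *\<^sub>R axis j 1)"
      by auto
    then have "diff_quot (h n) j f (X n) = g (X n + s *\<^sub>R axis j 1)"
      using h(2)[of n] by (simp add: diff_quot_def field_simps)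
    with near[of s] s d1(2) show ?case by (simp add: d_def)
  qed
qed

text \<open>If \<open>D\<close> were positive, \<open>\<phi>'\<close> would be positive just to the
  right of its zero \<open>0\<close>, and the mean value theorem would push \<open>\<phi>\<close>
  above its maximum.\<close>

lemma local_max_second_derivative:
  fixes \<phi> :: "real \<Rightarrow> real"
  assumes d: "d > 0"
    and \<phi>: "\<And>t. \<bar>t\<bar> < d \<Longrightarrow> (\<phi> has_real_derivative \<phi>' t) (at t)"
    and \<phi>': "(\<phi>' has_real_derivative D) (at 0)"
    and max: "\<And>t. \<bar>t\<bar> < d \<Longrightarrow> \<phi> t \<le> \<phi> 0"
  shows "\<phi>' 0 = 0" and "D \<le> 0"
proof -
  show 0: "\<phi>' 0 = 0"
    using DERIV_local_max[OF \<phi>[of 0] d] max d by simp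
  show "D \<le> 0"
  proof (rule ccontr)
    assume "\<not> D \<le> 0"
    then obtain e where e: "e > 0" "\<And>t. 0 < t \<Longrightarrow> t < e \<Longrightarrow> \<phi>' 0 < \<phi>' t"
      using DERIV_pos_inc_right[OF \<phi>'] by fastforce
    define s where "s = min d e / 2"
    have s: "0 < s" "s < d" "s < e" using d e by (auto simp: s_def)
    obtain t where t: "0 < t" "t < s" "\<phi> s - \<phi> 0 = (s - 0) * \<phi>' t"
      using MVT2[OF s(1), of \<phi> \<phi>'] \<phi> s by (metis abs_of_nonneg le_less_trans)
    then have "\<phi> s > \<phi> 0"
      using e(2)[of t] s 0 by (smt (verit) mult_pos_pos)
    then show False using max[of s] s by simp
  qed
qed

section \<open>The maximum principle for the squared gradient\<close>

text \<open>For each step size, the discretised squared gradient minus \<open>v\<close> is maximised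
  over \<open>cball x0 r\<close>; \<open>x\<close> is a limit of these maximum points. There the
  excess over \<open>v\<close> is still positive, so \<open>bdry\<close> keeps \<open>x\<close> off
  the sphere, and the first and second order conditions pass to the limit. The functions
  \<open>v1 i\<close> and \<open>v2 i\<close> are the first and pure second partial derivatives of
  \<open>v\<close>; \<open>g j\<close> stands for the \<open>j\<close>-th derivative of
  \<open>laplacian u\<close>.\<close>

lemma bernstein_touching_point:
  fixes u v :: "real ^ 'n \<Rightarrow> real"
  assumes u: "C2_on \<Omega> u" "open \<Omega>" "cball x0 R \<subseteq> \<Omega>"
    and r: "0 < r" "r < R"
    and v: "\<And>y i. y \<in> ball x0 R \<Longrightarrow> ((\<lambda>t. v (y + t *\<^sub>R axis i 1)) has_real_derivative v1 i y) (at 0)"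
    and v1: "\<And>y i. y \<in> ball x0 R \<Longrightarrow> ((\<lambda>t. v1 i (y + t *\<^sub>R axis i 1)) has_real_derivative v2 i y) (at 0)"
    and cont: "continuous_on (ball x0 R) v" "\<And>i. continuous_on (ball x0 R) (v1 i)"
      "\<And>i. continuous_on (ball x0 R) (v2 i)"
    and vpos: "\<And>y. y \<in> ball x0 R \<Longrightarrow> v y > 0"
    and bdry: "\<And>y. dist x0 y = r \<Longrightarrow> (norm (gradient u y))\<^sup>2 < v y"
    and above: "(norm (gradient u x0))\<^sup>2 > v x0"
    and g: "\<And>y j. y \<in> \<Omega> \<Longrightarrow> gradient u y \<noteq> 0 \<Longrightarrow>
        ((\<lambda>t. laplacian u (y + t *\<^sub>R axis j 1)) has_real_derivative g j y) (at 0)"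
    and g_cont: "\<And>y j. y \<in> \<Omega> \<Longrightarrow> gradient u y \<noteq> 0 \<Longrightarrow> isCont (g j) y"
  obtains x where "x \<in> ball x0 R" "(norm (gradient u x))\<^sup>2 > v x"
    and "\<And>i. (\<Sum>j\<in>UNIV. 2 * partial_deriv j u x * partial_deriv j (partial_deriv i u) x) = v1 i x"
    and "2 * (\<Sum>i\<in>UNIV. \<Sum>j\<in>UNIV. (partial_deriv j (partial_deriv i u) x)\<^sup>2)
         + 2 * (\<Sum>j\<in>UNIV. partial_deriv j u x * g j x) \<le> (\<Sum>i\<in>UNIV. v2 i x)"
proof -
  \<comment> \<open>The denominator exceeds 1 already for \<open>n = 0\<close>, so every step is
    shorter than \<open>R - r\<close> and translates of \<open>cball x0 r\<close> stay in
    \<open>ball x0 R\<close>.\<close>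
  define h where "h n = (R - r) / (real n + 2)" for n
  have h_pos: "h n > 0" for n using r by (simp add: h_def)
  have h_less: "h n < R - r" for n
    using r mult_strict_left_mono[of 1 "real n + 2" "R - r"] by (simp add: h_def divide_less_eq)
  have h_lim: "h \<longlonglongrightarrow> 0"
    using tendsto_mult_left[OF LIMSEQ_Suc[OF LIMSEQ_inverse_real_of_nat], of "R - r"]
    by (simp add: h_def[abs_def] divide_inverse add.commute)
  define z where "z n y = (\<Sum>j\<in>UNIV. (diff_quot (h n) j u y)\<^sup>2)" for n y
  have shift: "y + h n *\<^sub>R axis j 1 \<in> ball x0 R" if "y \<in> cball x0 r" for y j n
  proof -
    have "dist x0 (y + h n *\<^sub>R axis j 1) \<le> dist x0 y + dist y (y + h n *\<^sub>R axis j 1)"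
      by (rule dist_triangle)
    also have "dist y (y + h n *\<^sub>R axis j 1) = h n"
      using h_pos[of n] by (simp add: dist_norm norm_axis_1)
    finally show ?thesis using that h_less[of n] by simp
  qed
  have sub: "cball x0 r \<subseteq> ball x0 R" "ball x0 R \<subseteq> \<Omega>" using r u(3) by auto
  have ucont: "continuous_on \<Omega> u"
    by (meson C2_onD(1)[OF u(1)] continuous_at_imp_continuous_on differentiable_imp_continuous_within)
  have zcont: "continuous_on (cball x0 r) (\<lambda>y. z n y - v y)" for n
    unfolding z_def diff_quot_def
    using h_pos[of n] shift sub
    by (intro continuous_intros continuous_on_compose2[OF ucont] continuous_on_subset[OF cont(1)])
      (auto simp: less_imp_neq[symmetric])
  have "\<exists>x\<in>cball x0 r. \<forall>y\<in>cball x0 r. z n y - v y \<le> z n x - v x" for n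
    using continuous_attains_sup[OF compact_cball _ zcont[of n]] r by auto
  then obtain X where X: "\<And>n. X n \<in> cball x0 r"
      "\<And>n y. y \<in> cball x0 r \<Longrightarrow> z n y - v y \<le> z n (X n) - v (X n)"
    by metis
  obtain x s where x: "x \<in> cball x0 r" and s: "strict_mono (s :: nat \<Rightarrow> nat)" "(X \<circ> s) \<longlonglongrightarrow> x"
    using compact_cball[of x0 r] X(1) unfolding compact_def by metis
  define Y where "Y n = X (s n)" for n
  define k where "k n = h (s n)" for n
  have Y: "Y \<longlonglongrightarrow> x" using s(2) by (simp add: Y_def[abs_def] o_def)
  have k: "k \<longlonglongrightarrow> 0" "\<And>n. k n > 0"
    using LIMSEQ_subseq_LIMSEQ[OF h_lim s(1)] h_pos by (auto simp: k_def[abs_def] o_def)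
  have xR: "x \<in> ball x0 R" "x \<in> \<Omega>" using x sub by auto
  have isCont_pd: "isCont (partial_deriv i u) y" "isCont (partial_deriv j (partial_deriv i u)) y"
    if "y \<in> \<Omega>" for y i j
    using C2_onD(3,4)[OF u(1)] u(2) that by (auto simp: continuous_on_eq_continuous_at)
  have line: "((\<lambda>t. u (y + t *\<^sub>R axis i 1)) has_real_derivative partial_deriv i u y) (at 0)"
    "((\<lambda>t. partial_deriv j u (y + t *\<^sub>R axis i 1)) has_real_derivative partial_deriv i (partial_deriv j u) y) (at 0)"
    if "y \<in> \<Omega>" for y i j
    using has_line_derivative[of u y 0 i] has_line_derivative[of "partial_deriv j u" y 0 i]
      C2_onD(1,2)[OF u(1) that] by auto
  have lim_u: "(\<lambda>n. diff_quot (k n) j u (W n)) \<longlonglongrightarrow> partial_deriv j u w"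
    if "W \<longlonglongrightarrow> w" "w \<in> \<Omega>" for W w j
    by (rule diff_quot_tendsto[OF u(2) that(2) line(1) isCont_pd(1)[OF that(2)] that(1) k])
  have lim_pd: "(\<lambda>n. diff_quot (k n) j (partial_deriv i u) (Y n)) \<longlonglongrightarrow> partial_deriv j (partial_deriv i u) x"
    for i j
    by (rule diff_quot_tendsto[OF u(2) xR(2) line(2) isCont_pd(2)[OF xR(2)] Y k])
  have lim_z: "(\<lambda>n. z (s n) (W n)) \<longlonglongrightarrow> (norm (gradient u w))\<^sup>2"
    if "W \<longlonglongrightarrow> w" "w \<in> \<Omega>" for W w
    unfolding z_def norm_gradient_sq using lim_u[OF that]
    by (intro tendsto_sum tendsto_power) (simp add: k_def)
  have tendsto_v: "(\<lambda>n. f (W n)) \<longlonglongrightarrow> f w"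
    if "continuous_on (ball x0 R) f" "W \<longlonglongrightarrow> w" "w \<in> ball x0 R" for f :: "real ^ 'n \<Rightarrow> real" and W w
    using that isCont_tendsto_compose by (metis continuous_on_eq_continuous_at open_ball)
  have x0: "x0 \<in> ball x0 R" "x0 \<in> \<Omega>" "x0 \<in> cball x0 r" using r sub by auto
  \<comment> \<open>The maximality inequality, tested against the centre \<open>x0\<close>, survives
    the limit; this transfers \<open>above\<close> from \<open>x0\<close> to
    \<open>x\<close>.\<close>
  have "(norm (gradient u x0))\<^sup>2 - v x0 \<le> (norm (gradient u x))\<^sup>2 - v x"
  proof (rule LIMSEQ_le)
    show "(\<lambda>n. z (s n) x0 - v x0) \<longlonglongrightarrow> (norm (gradient u x0))\<^sup>2 - v x0"
      using lim_z[of "\<lambda>_. x0" x0] x0 by (intro tendsto_diff) auto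
    show "(\<lambda>n. z (s n) (Y n) - v (Y n)) \<longlonglongrightarrow> (norm (gradient u x))\<^sup>2 - v x"
      using lim_z[OF Y xR(2)] tendsto_v[OF cont(1) Y xR(1)] by (intro tendsto_diff)
    show "\<exists>N. \<forall>n\<ge>N. z (s n) x0 - v x0 \<le> z (s n) (Y n) - v (Y n)"
      using X(2)[OF x0(3)] by (auto simp: Y_def)
  qed
  with above have zx: "(norm (gradient u x))\<^sup>2 > v x" by linarith
  have xr: "x \<in> ball x0 r" using x bdry[of x] zx by force
  have gx: "gradient u x \<noteq> 0" using zx vpos[OF xR(1)] by auto
  \<comment> \<open>\<open>g\<close> is a derivative of \<open>laplacian u\<close> only away from
    critical points of \<open>u\<close>. Since the squared gradient at \<open>x\<close> exceeds
    \<open>v x > 0\<close>, the open set \<open>S\<close> is a neighbourhood of \<open>x\<close> on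
    which it can be used.\<close>
  define S where "S = {y \<in> \<Omega>. gradient u y \<noteq> 0}"
  have S: "open S" "x \<in> S"
  proof -
    have "continuous_on \<Omega> (gradient u)"
      unfolding gradient_def using C2_onD(3)[OF u(1)] by (intro continuous_intros) auto
    then have "open (\<Omega> \<inter> gradient u -` (- {0}))"
      using u(2) by (intro continuous_open_preimage) auto
    also have "\<Omega> \<inter> gradient u -` (- {0}) = S" by (auto simp: S_def)
    finally show "open S" .
    show "x \<in> S" using xR(2) gx by (simp add: S_def)
  qed
  have lim_lap: "(\<lambda>n. diff_quot (k n) j (laplacian u) (Y n)) \<longlonglongrightarrow> g j x" for j
    using diff_quot_tendsto[OF S, of "laplacian u" j "g j" Y k] g g_cont[OF xR(2) gx] Y k
    by (auto simp: S_def)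

  \<comment> \<open>Individual maximum points may lie on the sphere of radius \<open>r\<close>,
    where the derivative test fails; as \<open>x\<close> is interior, this stops for large
    \<open>n\<close>.\<close>
  have interior: "\<forall>\<^sub>F n in sequentially. Y n \<in> ball x0 r"
    using Y xr topological_tendstoD[OF Y open_ball] by blast
  have test: "(\<Sum>j\<in>UNIV. 2 * diff_quot (k n) j u (Y n) * diff_quot (k n) j (partial_deriv i u) (Y n)) = v1 i (Y n)
      \<and> (\<Sum>j\<in>UNIV. 2 * ((diff_quot (k n) j (partial_deriv i u) (Y n))\<^sup>2
          + diff_quot (k n) j u (Y n) * diff_quot (k n) j (partial_deriv i (partial_deriv i u)) (Y n)))
        \<le> v2 i (Y n)" if Yn: "Y n \<in> ball x0 r" for n i
  proof -
    define p where "p t = Y n + t *\<^sub>R axis i (1::real)" for t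
    define d where "d = r - dist x0 (Y n)"
    have d: "d > 0" using Yn by (simp add: d_def)
    have p: "p t \<in> ball x0 r" if "\<bar>t\<bar> < d" for t
    proof -
      have "dist x0 (p t) \<le> dist x0 (Y n) + dist (Y n) (p t)" by (rule dist_triangle)
      also have "dist (Y n) (p t) = \<bar>t\<bar>" by (simp add: p_def dist_norm norm_axis_1)
      finally show ?thesis using that by (simp add: d_def)
    qed
    have pR: "p t \<in> ball x0 R" "p t \<in> \<Omega>" "p t + k n *\<^sub>R axis j 1 \<in> \<Omega>" if "\<bar>t\<bar> < d" for t j
      using p[OF that] r sub shift[of "p t"] by (auto simp: k_def)
    have move: "((\<lambda>t. f (p t + c)) has_real_derivative D) (at t)"
      if "((\<lambda>s. f ((p t + c) + s *\<^sub>R axis i 1)) has_real_derivative D) (at 0)" for f D c t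
    proof -
      have "(\<lambda>s. f ((p t + c) + s *\<^sub>R axis i 1)) = (\<lambda>s. f (p (s + t) + c))"
        by (simp add: p_def scaleR_add_left algebra_simps)
      with that show ?thesis using DERIV_shift[of "\<lambda>t. f (p t + c)" D 0 t] by simp
    qed
    have dq_der: "((\<lambda>t. diff_quot (k n) j f (p t)) has_real_derivative diff_quot (k n) j f' (p t)) (at t)"
      if t: "\<bar>t\<bar> < d"
        and f: "\<And>y. y \<in> \<Omega> \<Longrightarrow> ((\<lambda>t. f (y + t *\<^sub>R axis i 1)) has_real_derivative f' y) (at 0)" for f f' t j
      unfolding diff_quot_def
      using move[of f t "k n *\<^sub>R axis j 1", OF f] move[of f t 0, OF f] pR[OF t]
      by (intro DERIV_cdivide DERIV_diff) simp_all
    define \<phi> where "\<phi> t = z (s n) (p t) - v (p t)" for t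
    define \<phi>' where "\<phi>' t = (\<Sum>j\<in>UNIV. 2 * diff_quot (k n) j u (p t) *
      diff_quot (k n) j (partial_deriv i u) (p t)) - v1 i (p t)" for t
    have d1: "(\<phi> has_real_derivative \<phi>' t) (at t)" if t: "\<bar>t\<bar> < d" for t
      unfolding \<phi>_def \<phi>'_def z_def k_def[symmetric]
      using dq_der[OF t line(1)] move[of v t 0, OF v] pR(1)[OF t]
      by (auto intro!: derivative_eq_intros sum.cong)
    define D where "D = (\<Sum>j\<in>UNIV. 2 * ((diff_quot (k n) j (partial_deriv i u) (Y n))\<^sup>2
          + diff_quot (k n) j u (Y n) * diff_quot (k n) j (partial_deriv i (partial_deriv i u)) (Y n)))
        - v2 i (Y n)"
    have p0: "p 0 = Y n" by (simp add: p_def)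
    have d2: "(\<phi>' has_real_derivative D) (at 0)"
      unfolding \<phi>'_def D_def
      using dq_der[OF _ line(1), of 0] dq_der[OF _ line(2), of 0] move[of "v1 i" 0 0, OF v1] pR(1)[of 0] d
      by (auto intro!: derivative_eq_intros sum.cong simp: p0 power2_eq_square algebra_simps)
    have "\<phi> t \<le> \<phi> 0" if "\<bar>t\<bar> < d" for t
      using X(2)[of "p t" "s n"] p[OF that] by (simp add: \<phi>_def p0 Y_def)
    from local_max_second_derivative[OF d d1 d2 this] show ?thesis
      by (simp add: \<phi>'_def D_def p0)
  qed
  show ?thesis
  proof (rule that[of x])
    show "x \<in> ball x0 R" "(norm (gradient u x))\<^sup>2 > v x" by fact+
    show "(\<Sum>j\<in>UNIV. 2 * partial_deriv j u x * partial_deriv j (partial_deriv i u) x) = v1 i x" for i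
    proof (rule tendsto_unique)
      show "(\<lambda>n. \<Sum>j\<in>UNIV. 2 * diff_quot (k n) j u (Y n) * diff_quot (k n) j (partial_deriv i u) (Y n))
        \<longlonglongrightarrow> (\<Sum>j\<in>UNIV. 2 * partial_deriv j u x * partial_deriv j (partial_deriv i u) x)"
        using lim_u[OF Y xR(2)] lim_pd by (intro tendsto_intros)
      have "\<forall>\<^sub>F n in sequentially. v1 i (Y n) =
          (\<Sum>j\<in>UNIV. 2 * diff_quot (k n) j u (Y n) * diff_quot (k n) j (partial_deriv i u) (Y n))"
        using interior by eventually_elim (use test in metis)
      then show "(\<lambda>n. \<Sum>j\<in>UNIV. 2 * diff_quot (k n) j u (Y n) * diff_quot (k n) j (partial_deriv i u) (Y n))
        \<longlonglongrightarrow> v1 i x"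
        by (rule Lim_transform_eventually[OF tendsto_v[OF cont(2) Y xR(1)]])
    qed simp
    \<comment> \<open>Summing the second-order conditions over the directions \<open>i\<close>
      recombines the quotients of pure second derivatives into quotients of
      \<open>laplacian u\<close>. These converge to \<open>g\<close> by the equation, although third
      derivatives of \<open>u\<close> need not exist.\<close>
    have dq_lap: "diff_quot c j (laplacian u) y = (\<Sum>i\<in>UNIV. diff_quot c j (partial_deriv i (partial_deriv i u)) y)"
      for c j y
      by (simp add: diff_quot_def laplacian_def sum_subtractf flip: sum_divide_distrib)
    have "2 * (\<Sum>i\<in>UNIV. \<Sum>j\<in>UNIV. (diff_quot (k n) j (partial_deriv i u) (Y n))\<^sup>2)
         + 2 * (\<Sum>j\<in>UNIV. diff_quot (k n) j u (Y n) * diff_quot (k n) j (laplacian u) (Y n))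
        \<le> (\<Sum>i\<in>UNIV. v2 i (Y n))" if "Y n \<in> ball x0 r" for n
    proof -
      have "(\<Sum>i\<in>UNIV. \<Sum>j\<in>UNIV. 2 * ((diff_quot (k n) j (partial_deriv i u) (Y n))\<^sup>2
          + diff_quot (k n) j u (Y n) * diff_quot (k n) j (partial_deriv i (partial_deriv i u)) (Y n)))
        \<le> (\<Sum>i\<in>UNIV. v2 i (Y n))"
        using test[OF that] by (intro sum_mono) blast
      moreover have "(\<Sum>j\<in>UNIV. diff_quot (k n) j u (Y n) * diff_quot (k n) j (laplacian u) (Y n))
        = (\<Sum>i\<in>UNIV. \<Sum>j\<in>UNIV. diff_quot (k n) j u (Y n) * diff_quot (k n) j (partial_deriv i (partial_deriv i u)) (Y n))"
        unfolding dq_lap sum_distrib_left by (rule sum.swap)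
      ultimately show ?thesis
        by (simp add: sum.distrib flip: sum_distrib_left)
    qed
    then have "\<forall>\<^sub>F n in sequentially. 2 * (\<Sum>i\<in>UNIV. \<Sum>j\<in>UNIV. (diff_quot (k n) j (partial_deriv i u) (Y n))\<^sup>2)
         + 2 * (\<Sum>j\<in>UNIV. diff_quot (k n) j u (Y n) * diff_quot (k n) j (laplacian u) (Y n))
        \<le> (\<Sum>i\<in>UNIV. v2 i (Y n))"
      using interior eventually_mono by force
    moreover have "(\<lambda>n. 2 * (\<Sum>i\<in>UNIV. \<Sum>j\<in>UNIV. (diff_quot (k n) j (partial_deriv i u) (Y n))\<^sup>2)
         + 2 * (\<Sum>j\<in>UNIV. diff_quot (k n) j u (Y n) * diff_quot (k n) j (laplacian u) (Y n)))
       \<longlonglongrightarrow> 2 * (\<Sum>i\<in>UNIV. \<Sum>j\<in>UNIV. (partial_deriv j (partial_deriv i u) x)\<^sup>2)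
         + 2 * (\<Sum>j\<in>UNIV. partial_deriv j u x * g j x)"
      using lim_u[OF Y xR(2)] lim_pd lim_lap by (intro tendsto_intros)
    moreover have "(\<lambda>n. \<Sum>i\<in>UNIV. v2 i (Y n)) \<longlonglongrightarrow> (\<Sum>i\<in>UNIV. v2 i x)"
      using tendsto_v[OF cont(3) Y xR(1)] by (intro tendsto_intros)
    ultimately show "2 * (\<Sum>i\<in>UNIV. \<Sum>j\<in>UNIV. (partial_deriv j (partial_deriv i u) x)\<^sup>2)
         + 2 * (\<Sum>j\<in>UNIV. partial_deriv j u x * g j x) \<le> (\<Sum>i\<in>UNIV. v2 i x)"
      using tendsto_le[OF trivial_limit_sequentially] by blast
  qed
qed

text \<open>At the touching point the gradients of \<open>v\<close> and of the squared gradient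
  agree. Differentiating the equation therefore leaves only \<open>v1\<close>, \<open>u\<close> and
  \<open>gradient u\<close>, while the Hessian is bounded below through the Laplacian, that is,
  again through the equation.\<close>

lemma bernstein_inequality:
  fixes u v :: "real ^ 'n \<Rightarrow> real"
  assumes sol: "positive_solution p q M \<Omega> u" and Om: "open \<Omega>" "cball x0 R \<subseteq> \<Omega>"
    and M: "M > 0"
    and r: "0 < r" "r < R"
    and v: "\<And>y i. y \<in> ball x0 R \<Longrightarrow> ((\<lambda>t. v (y + t *\<^sub>R axis i 1)) has_real_derivative v1 i y) (at 0)"
    and v1: "\<And>y i. y \<in> ball x0 R \<Longrightarrow> ((\<lambda>t. v1 i (y + t *\<^sub>R axis i 1)) has_real_derivative v2 i y) (at 0)"
    and cont: "continuous_on (ball x0 R) v" "\<And>i. continuous_on (ball x0 R) (v1 i)"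
      "\<And>i. continuous_on (ball x0 R) (v2 i)"
    and vpos: "\<And>y. y \<in> ball x0 R \<Longrightarrow> v y > 0"
    and bdry: "\<And>y. dist x0 y = r \<Longrightarrow> (norm (gradient u y))\<^sup>2 < v y"
    and above: "(norm (gradient u x0))\<^sup>2 > v x0"
  obtains x where "x \<in> ball x0 R" "(norm (gradient u x))\<^sup>2 > v x" "u x > 0"
    and "2 / CARD('n) * (u x powr (2 * p) + M\<^sup>2 * (norm (gradient u x))\<^sup>2 powr q)
      \<le> (\<Sum>i\<in>UNIV. v2 i x) + 2 * p * u x powr (p - 1) * (norm (gradient u x))\<^sup>2
        + M * q * (norm (gradient u x))\<^sup>2 powr (q / 2 - 1) * (gradient u x \<bullet> (\<chi> i. v1 i x))"
proof -
  have C2: "C2_on \<Omega> u" and pos: "\<And>y. y \<in> \<Omega> \<Longrightarrow> u y > 0"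
    and eq: "\<And>y. y \<in> \<Omega> \<Longrightarrow> - laplacian u y = \<bar>u y\<bar> powr (p - 1) * u y + M * norm (gradient u y) powr q"
    using sol by (auto simp: positive_solution_def)
  define z where "z y = (\<Sum>i\<in>UNIV. (partial_deriv i u y)\<^sup>2)" for y
  have z: "(norm (gradient u y))\<^sup>2 = z y" for y by (simp add: norm_gradient_sq z_def)
  have z_nonneg: "z y \<ge> 0" for y by (simp add: z_def sum_nonneg)
  have z_pos: "z y > 0" if "gradient u y \<noteq> 0" for y
    using z[of y] that by (metis zero_less_norm_iff zero_less_power)
  have lap: "- laplacian u y = u y powr p + M * z y powr (q / 2)" if "y \<in> \<Omega>" for y
  proof -
    have "\<bar>u y\<bar> powr (p - 1) * u y = u y powr p"
      using pos[OF that] by (simp add: powr_diff)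
    moreover have "norm (gradient u y) powr q = z y powr (q / 2)"
      using powr_half_sqrt[OF z_nonneg[of y]] z[of y, symmetric]
      by (metis norm_ge_zero powr_powr real_sqrt_abs abs_of_nonneg mult.commute times_divide_eq_right mult_1_right)
    ultimately show ?thesis using eq[OF that] by simp
  qed
  \<comment> \<open>The \<open>j\<close>-th derivative of
    \<open>- (u powr p + M * z powr (q / 2))\<close>. The exponent \<open>q / 2 - 1\<close> may be
    negative, hence the restriction to points with nonzero gradient.\<close>
  define g where "g j y = - (p * u y powr (p - 1) * partial_deriv j u y + M * (q / 2) * z y powr (q / 2 - 1)
      * (\<Sum>i\<in>UNIV. 2 * partial_deriv i u y * partial_deriv j (partial_deriv i u) y))" for j y
  have line: "((\<lambda>t. u (y + t *\<^sub>R axis i 1)) has_real_derivative partial_deriv i u y) (at 0)"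
    "((\<lambda>t. partial_deriv j u (y + t *\<^sub>R axis i 1)) has_real_derivative partial_deriv i (partial_deriv j u) y) (at 0)"
    if "y \<in> \<Omega>" for y i j
    using has_line_derivative[of u y 0 i] has_line_derivative[of "partial_deriv j u" y 0 i]
      C2_onD(1,2)[OF C2 that] by auto
  have g: "((\<lambda>t. laplacian u (y + t *\<^sub>R axis j 1)) has_real_derivative g j y) (at 0)"
    if y: "y \<in> \<Omega>" "gradient u y \<noteq> 0" for y j
  proof (rule has_field_derivative_transform_within_open)
    let ?S = "(\<lambda>t. y + t *\<^sub>R axis j (1::real)) -` \<Omega>"
    show "open ?S" using Om(1) by (intro open_vimage continuous_intros)
    show "0 \<in> ?S" using y by simp
    show "- (u (y + t *\<^sub>R axis j 1) powr p + M * z (y + t *\<^sub>R axis j 1) powr (q / 2))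
        = laplacian u (y + t *\<^sub>R axis j 1)" if "t \<in> ?S" for t
      using lap[of "y + t *\<^sub>R axis j 1"] that by simp
    have zd: "((\<lambda>t. z (y + t *\<^sub>R axis j 1)) has_real_derivative
        (\<Sum>i\<in>UNIV. 2 * partial_deriv i u y * partial_deriv j (partial_deriv i u) y)) (at 0)"
      unfolding z_def using line(2)[OF y(1)] by (auto intro!: derivative_eq_intros sum.cong)
    have du: "((\<lambda>t. u (y + t *\<^sub>R axis j 1) powr p) has_real_derivative
        p * u y powr (p - 1) * partial_deriv j u y) (at 0)"
      using DERIV_fun_powr[OF line(1)[OF y(1)], where r = p] pos[OF y(1)] by simp
    have dz: "((\<lambda>t. z (y + t *\<^sub>R axis j 1) powr (q / 2)) has_real_derivative
        q / 2 * z y powr (q / 2 - 1) * (\<Sum>i\<in>UNIV. 2 * partial_deriv i u y * partial_deriv j (partial_deriv i u) y)) (at 0)"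
      using DERIV_fun_powr[OF zd, where r = "q / 2"] z_pos[OF y(2)] by simp
    show "((\<lambda>t. - (u (y + t *\<^sub>R axis j 1) powr p + M * z (y + t *\<^sub>R axis j 1) powr (q / 2)))
        has_real_derivative g j y) (at 0)"
      using DERIV_minus[OF DERIV_add[OF du DERIV_cmult[OF dz, of M]]]
      unfolding g_def by (simp only: mult.assoc)
  qed
  have g_cont: "isCont (g j) y" if y: "y \<in> \<Omega>" "gradient u y \<noteq> 0" for y j
  proof -
    have "isCont u y" "isCont (partial_deriv i u) y" "isCont (partial_deriv l (partial_deriv i u)) y" for i l
      using C2_onD[OF C2] y Om(1)
      by (auto simp: continuous_on_eq_continuous_at differentiable_imp_continuous_within)
    then show ?thesis
      unfolding g_def z_def using pos[OF y(1)] z_pos[OF y(2)]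
      by (intro continuous_intros) (auto simp: z_def)
  qed
  obtain x where x: "x \<in> ball x0 R" "(norm (gradient u x))\<^sup>2 > v x"
    and first: "\<And>i. (\<Sum>j\<in>UNIV. 2 * partial_deriv j u x * partial_deriv j (partial_deriv i u) x) = v1 i x"
    and second: "2 * (\<Sum>i\<in>UNIV. \<Sum>j\<in>UNIV. (partial_deriv j (partial_deriv i u) x)\<^sup>2)
         + 2 * (\<Sum>j\<in>UNIV. partial_deriv j u x * g j x) \<le> (\<Sum>i\<in>UNIV. v2 i x)"
    using bernstein_touching_point[OF C2 Om r v v1 cont vpos bdry above g g_cont] by blast
  have xO: "x \<in> \<Omega>" using x(1) Om(2) by auto
  \<comment> \<open>Exchanging the sums makes the inner sum run over \<open>j\<close>, exactly as in
    \<open>first\<close>, so that it can be replaced by \<open>v1 i x\<close>.\<close>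
  have "(\<Sum>j\<in>UNIV. partial_deriv j u x * (\<Sum>i\<in>UNIV. 2 * partial_deriv i u x * partial_deriv j (partial_deriv i u) x))
    = (\<Sum>i\<in>UNIV. \<Sum>j\<in>UNIV. partial_deriv j u x * (2 * partial_deriv i u x * partial_deriv j (partial_deriv i u) x))"
    unfolding sum_distrib_left by (rule sum.swap)
  also have "\<dots> = (\<Sum>i\<in>UNIV. partial_deriv i u x * v1 i x)"
    unfolding first[symmetric] sum_distrib_left by (simp add: mult_ac)
  also have "\<dots> = gradient u x \<bullet> (\<chi> i. v1 i x)"
    by (simp add: inner_vec_def gradient_def)
  finally have cross: "(\<Sum>j\<in>UNIV. partial_deriv j u x * (\<Sum>i\<in>UNIV. 2 * partial_deriv i u x * partial_deriv j (partial_deriv i u) x))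
    = gradient u x \<bullet> (\<chi> i. v1 i x)" .
  have "partial_deriv j u x * g j x = - (p * u x powr (p - 1)) * (partial_deriv j u x)\<^sup>2
      - (M * (q / 2) * z x powr (q / 2 - 1)) * (partial_deriv j u x *
        (\<Sum>i\<in>UNIV. 2 * partial_deriv i u x * partial_deriv j (partial_deriv i u) x))" for j
    by (simp add: g_def algebra_simps power2_eq_square)
  then have source: "(\<Sum>j\<in>UNIV. partial_deriv j u x * g j x) = - (p * u x powr (p - 1)) * z x
      - (M * (q / 2) * z x powr (q / 2 - 1)) * (gradient u x \<bullet> (\<chi> i. v1 i x))"
    by (simp only: sum_subtractf sum_distrib_left[symmetric] z_def cross)
  \<comment> \<open>The cross term of the square is nonnegative and dropped; then Cauchy-Schwarz on
    the diagonal of the Hessian costs the factor \<open>CARD('n)\<close>, and the off-diagonal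
    squares are added.\<close>
  have hessian: "(u x powr (2 * p) + M\<^sup>2 * z x powr q) / CARD('n)
      \<le> (\<Sum>i\<in>UNIV. \<Sum>j\<in>UNIV. (partial_deriv j (partial_deriv i u) x)\<^sup>2)"
  proof -
    have "u x powr (2 * p) + M\<^sup>2 * z x powr q \<le> (u x powr p + M * z x powr (q / 2))\<^sup>2"
    proof -
      have "(u x powr p)\<^sup>2 = u x powr (2 * p)" "(z x powr (q / 2))\<^sup>2 = z x powr q"
        by (simp_all add: power2_eq_square flip: powr_add)
      moreover have "0 \<le> 2 * u x powr p * (M * z x powr (q / 2))" using M by simp
      ultimately show ?thesis by (simp add: power2_sum power_mult_distrib)
    qed
    also have "\<dots> = (laplacian u x)\<^sup>2"
      unfolding lap[OF xO, symmetric] by simp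
    also have "\<dots> \<le> CARD('n) * (\<Sum>i\<in>UNIV. (partial_deriv i (partial_deriv i u) x)\<^sup>2)"
      unfolding laplacian_def
      using sum_squared_le_sum_of_squares[of "\<lambda>i. partial_deriv i (partial_deriv i u) x" UNIV]
      by (simp add: mult.commute)
    also have "(\<Sum>i\<in>UNIV. (partial_deriv i (partial_deriv i u) x)\<^sup>2)
        \<le> (\<Sum>i\<in>UNIV. \<Sum>j\<in>UNIV. (partial_deriv j (partial_deriv i u) x)\<^sup>2)"
      by (intro sum_mono member_le_sum[of _ UNIV "\<lambda>j. (partial_deriv j (partial_deriv _ u) x)\<^sup>2"]) auto
    finally show ?thesis by (simp add: divide_le_eq mult.commute)
  qed
  have "2 * (\<Sum>j\<in>UNIV. partial_deriv j u x * g j x) = - (2 * p * u x powr (p - 1) * z x)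
      - M * q * z x powr (q / 2 - 1) * (gradient u x \<bullet> (\<chi> i. v1 i x))"
    unfolding source by (simp add: algebra_simps)
  moreover have "2 / CARD('n) * (u x powr (2 * p) + M\<^sup>2 * z x powr q)
      = 2 * ((u x powr (2 * p) + M\<^sup>2 * z x powr q) / CARD('n))" by simp
  ultimately have "2 / CARD('n) * (u x powr (2 * p) + M\<^sup>2 * z x powr q)
      \<le> (\<Sum>i\<in>UNIV. v2 i x) + 2 * p * u x powr (p - 1) * z x
        + M * q * z x powr (q / 2 - 1) * (gradient u x \<bullet> (\<chi> i. v1 i x))"
    using second hessian by linarith
  with x pos[OF xO] show ?thesis by (intro that[of x]) (simp_all add: z)
qed

section \<open>The barrier on a ball\<close>

text \<open>A case split in place of Young's inequality. For \<open>z\<close> small against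
  \<open>a powr (p + 1)\<close> the first term on the right suffices, and the threshold
  \<open>p * n\<close> produces exactly its coefficient \<open>2 / n\<close>; otherwise
  \<open>a powr (p - 1)\<close> is bounded by a power of \<open>z\<close>.\<close>

lemma reaction_term_young:
  fixes p n a z :: real
  assumes "p > 1" "n > 0" "a > 0" "z \<ge> 0"
  shows "2 * p * a powr (p - 1) * z \<le> 2 / n * a powr (2 * p)
    + 2 * p * (p * n) powr ((p - 1) / (p + 1)) * z powr (2 * p / (p + 1))"
proof (cases "p * n * z \<le> a powr (p + 1)")
  case True
  have "a powr (p - 1) * (p * n * z) \<le> a powr (p - 1) * a powr (p + 1)"
    using True by (intro mult_left_mono) auto
  also have "\<dots> = a powr (2 * p)" by (simp flip: powr_add)
  finally have "2 * p * a powr (p - 1) * z \<le> 2 / n * a powr (2 * p)"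
    using assms by (simp add: field_simps)
  moreover have "0 \<le> 2 * p * (p * n) powr ((p - 1) / (p + 1)) * z powr (2 * p / (p + 1))"
    using assms by simp
  ultimately show ?thesis by linarith
next
  case False
  then have "(a powr (p + 1)) powr ((p - 1) / (p + 1)) \<le> (p * n * z) powr ((p - 1) / (p + 1))"
    using assms by (intro powr_mono2) auto
  then have "a powr (p - 1) \<le> (p * n) powr ((p - 1) / (p + 1)) * z powr ((p - 1) / (p + 1))"
    using assms by (simp add: powr_powr powr_mult)
  then have "a powr (p - 1) * z \<le> (p * n) powr ((p - 1) / (p + 1)) * (z powr ((p - 1) / (p + 1)) * z)"
    using mult_right_mono[OF _ assms(4)] by (fastforce simp: mult.assoc)
  also have "z powr ((p - 1) / (p + 1)) * z = z powr ((p - 1) / (p + 1) + 1)"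
    using assms by (simp add: powr_add)
  also have "(p - 1) / (p + 1) + 1 = 2 * p / (p + 1)" using assms by (simp add: field_simps)
  finally have "2 * p * a powr (p - 1) * z
      \<le> 2 * p * (p * n) powr ((p - 1) / (p + 1)) * z powr (2 * p / (p + 1))"
    using mult_left_mono[of _ _ "2 * p"] assms by (fastforce simp: mult.assoc)
  moreover have "0 \<le> 2 / n * a powr (2 * p)" using assms by simp
  ultimately show ?thesis by linarith
qed

text \<open>Along a line the base is a quadratic polynomial in \<open>t\<close>. Used with exponents
  \<open>- k\<close> and \<open>- k - 1\<close>, this one formula yields both derivatives of the
  barrier.\<close>

lemma radial_power_line_derivative:
  fixes x0 y :: "real ^ 'n"
  assumes "y \<in> ball x0 R"
  shows "((\<lambda>t. (R\<^sup>2 - (norm (y + t *\<^sub>R axis i 1 - x0))\<^sup>2) powr a) has_real_derivative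
    - 2 * a * (y - x0) $ i * (R\<^sup>2 - (norm (y - x0))\<^sup>2) powr (a - 1)) (at 0)"
proof -
  have pos: "R\<^sup>2 - (norm (y - x0))\<^sup>2 > 0"
    using assms by (simp add: dist_norm norm_minus_commute power_strict_mono)
  have eq: "R\<^sup>2 - (norm (y + t *\<^sub>R axis i 1 - x0))\<^sup>2 = R\<^sup>2 - (norm (y - x0))\<^sup>2 - 2 * t * (y - x0) $ i - t\<^sup>2" for t
  proof -
    have "y + t *\<^sub>R axis i 1 - x0 = (y - x0) + t *\<^sub>R axis i 1" by simp
    then show ?thesis
      by (simp only: power2_norm_eq_inner inner_add_left inner_add_right)
        (simp add: inner_axis inner_axis' power2_eq_square algebra_simps)
  qed
  have "((\<lambda>t. R\<^sup>2 - (norm (y - x0))\<^sup>2 - 2 * t * (y - x0) $ i - t\<^sup>2) has_real_derivative - 2 * (y - x0) $ i) (at 0)"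
    by (auto intro!: derivative_eq_intros)
  from DERIV_fun_powr[OF this, of a] pos
  have "((\<lambda>t. (R\<^sup>2 - (norm (y - x0))\<^sup>2 - 2 * t * (y - x0) $ i - t\<^sup>2) powr a) has_real_derivative
    a * (R\<^sup>2 - (norm (y - x0))\<^sup>2) powr (a - 1) * (- 2 * (y - x0) $ i)) (at 0)" by simp
  then show ?thesis unfolding eq by (simp only: mult_ac)
qed

text \<open>The right-hand side is the value at the centre of the barrier
  \<open>v = A + B * D powr (- k)\<close>, so a failure of the estimate is the hypothesis
  \<open>above\<close> of the Bernstein inequality. At the touching point the term
  \<open>2 / n * (M\<^sup>2 * z powr q)\<close> then outweighs everything else.\<close>

lemma gradient_estimate_ball:
  fixes p q :: real
  assumes p: "p > 1" and q: "q > 2 * p / (p + 1)"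
  shows "\<exists>K>0. \<exists>C>0. \<forall>M>0. \<forall>R>0. \<forall>\<Omega> (u :: real ^ 'n \<Rightarrow> real) x0.
    positive_solution p q M \<Omega> u \<and> open \<Omega> \<and> cball x0 R \<subseteq> \<Omega> \<longrightarrow>
    (norm (gradient u x0))\<^sup>2 \<le> (K / M\<^sup>2) powr (1 / (q - 2 * p / (p + 1))) + (C / (M * R)) powr (2 / (q - 1))"
proof -
  define n where "n = real CARD('n)"
  define s where "s = 2 * p / (p + 1)"
  define k where "k = 2 / (q - 1)"
  \<comment> \<open>\<open>K\<close> is \<open>n\<close> times the constant of
    \<open>reaction_term_young\<close>. In \<open>C\<close>, the first two summands serve the
    gradient and the Laplacian of the barrier; the final 1 gives
    \<open>C\<^sup>2 \<ge> C\<close>.\<close>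
  define K where "K = n * (2 * p * (p * n) powr ((p - 1) / (p + 1)))"
  define C where "C = 4 * n * k * q + 2 * n * (2 * k * n + 4 * k * (k + 1)) + 1"
  have n: "n > 0" by (simp add: n_def)
  have s: "s > 1" using p by (simp add: s_def field_simps)
  have qs: "q > s" using q by (simp add: s_def)
  have q1: "q > 1" using s qs by simp
  have k: "k > 0" using q1 by (simp add: k_def)
  have K: "K > 0" using p n by (simp add: K_def)
  have C: "C \<ge> 1" "C \<ge> 4 * n * k * q" "C \<ge> 2 * n * (2 * k * n + 4 * k * (k + 1))"
    using n k q1 by (simp_all add: C_def)
  have C_sq: "C\<^sup>2 \<ge> 2 * n * (2 * k * n + 4 * k * (k + 1))"
    using C(3) mult_left_mono[OF C(1), of C] C(1) unfolding power2_eq_square by linarith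
  have "(norm (gradient u x0))\<^sup>2 \<le> (K / M\<^sup>2) powr (1 / (q - s)) + (C / (M * R)) powr k"
    if M: "M > 0" and R: "R > 0" and sol: "positive_solution p q M \<Omega> u"
      and Om: "open \<Omega>" "cball x0 R \<subseteq> \<Omega>" for M R \<Omega> x0 and u :: "real ^ 'n \<Rightarrow> real"
  proof (rule ccontr)
    define A where "A = (K / M\<^sup>2) powr (1 / (q - s))"
    define B where "B = (C * R / M) powr k"
    define D where "D y = R\<^sup>2 - (norm (y - x0))\<^sup>2" for y :: "real ^ 'n"
    define v where "v y = A + B * D y powr (- k)" for y
    define v1 where "v1 i y = 2 * k * B * D y powr (- k - 1) * (y - x0) $ i" for i y
    define v2 where "v2 i y = 2 * k * B * D y powr (- k - 1)
        + 4 * k * (k + 1) * B * ((y - x0) $ i)\<^sup>2 * D y powr (- k - 2)" for i y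
    have A: "A > 0" using K M by (simp add: A_def)
    have B: "B > 0" using C(1) M R by (simp add: B_def)
    have D: "D y > 0" if "y \<in> ball x0 R" for y
      using that by (simp add: D_def dist_norm norm_minus_commute power_strict_mono)
    have D_pow: "D y powr a > 0" if "y \<in> ball x0 R" for y a using D[OF that] by simp
    have D_line: "((\<lambda>t. D (y + t *\<^sub>R axis i 1) powr a) has_real_derivative
        - 2 * a * (y - x0) $ i * D y powr (a - 1)) (at 0)" if "y \<in> ball x0 R" for y i a
      unfolding D_def by (rule radial_power_line_derivative[OF that])
    assume "\<not> (norm (gradient u x0))\<^sup>2 \<le> (K / M\<^sup>2) powr (1 / (q - s)) + (C / (M * R)) powr k"
    moreover have "B * D x0 powr (- k) = (C / (M * R)) powr k"
    proof -
      have "D x0 powr (- k) = (1 / R\<^sup>2) powr k"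
        using R by (simp add: D_def powr_minus powr_divide inverse_eq_divide)
      then show ?thesis
        using C(1) M R by (simp add: B_def power2_eq_square flip: powr_mult)
    qed
    ultimately have above: "(norm (gradient u x0))\<^sup>2 > v x0" by (simp add: v_def A_def)
    have "continuous_on \<Omega> (gradient u)"
      unfolding gradient_def using sol C2_onD(3)[of \<Omega> u]
      by (intro continuous_intros) (auto simp: positive_solution_def)
    then have "compact ((\<lambda>y. (norm (gradient u y))\<^sup>2) ` cball x0 R)"
      using Om(2) by (intro compact_continuous_image continuous_intros) (auto intro: continuous_on_subset)
    then have "bdd_above ((\<lambda>y. (norm (gradient u y))\<^sup>2) ` cball x0 R)"
      by (intro bounded_imp_bdd_above compact_imp_bounded)
    then obtain Z where Z: "\<And>y. y \<in> cball x0 R \<Longrightarrow> (norm (gradient u y))\<^sup>2 \<le> Z"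
      unfolding bdd_above_def by blast
    \<comment> \<open>The radius \<open>r\<close> is chosen so that the singular part of
      \<open>v\<close> equals \<open>Z'\<close> on the sphere, hence is at least the bound
      \<open>Z\<close>. The second entry of the maximum forces \<open>D \<le> R\<^sup>2 / 2\<close>
      there, so the square root defining \<open>r\<close> is positive.\<close>
    define Z' where "Z' = max Z (B * (R\<^sup>2 / 2) powr (- k))"
    have Z': "Z' > 0" using B R by (simp add: Z'_def less_max_iff_disj)
    define r where "r = sqrt (R\<^sup>2 - (B / Z') powr (1 / k))"
    have small: "(B / Z') powr (1 / k) \<le> R\<^sup>2 / 2"
    proof -
      have "B * (R\<^sup>2 / 2) powr (- k) \<le> Z'" by (simp add: Z'_def)
      then have "B / Z' \<le> (R\<^sup>2 / 2) powr k"
        using Z' R by (simp add: powr_minus field_simps)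
      then have "(B / Z') powr (1 / k) \<le> ((R\<^sup>2 / 2) powr k) powr (1 / k)"
        using B Z' k by (intro powr_mono2) auto
      also have "\<dots> = R\<^sup>2 / 2" using k R by (simp add: powr_powr)
      finally show ?thesis .
    qed
    have BZ: "(B / Z') powr (1 / k) > 0" using B Z' by simp
    have R2: "R\<^sup>2 > 0" using R by simp
    have r_sq: "r\<^sup>2 = R\<^sup>2 - (B / Z') powr (1 / k)"
    proof -
      have "0 \<le> R\<^sup>2 - (B / Z') powr (1 / k)" using small R2 by linarith
      then show ?thesis unfolding r_def by (rule real_sqrt_pow2)
    qed
    have r0: "r > 0" unfolding r_def using small R2 by (intro real_sqrt_gt_zero) linarith
    have rR: "r < R" using r_sq BZ R by (intro power_less_imp_less_base[of r 2 R]) auto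
    have bdry: "(norm (gradient u y))\<^sup>2 < v y" if "dist x0 y = r" for y
    proof -
      have "D y = (B / Z') powr (1 / k)"
        using that r_sq by (simp add: D_def dist_norm norm_minus_commute)
      then have "B * D y powr (- k) = Z'"
        using k B Z' by (simp add: powr_powr powr_minus)
      then have "v y > Z" using A by (simp add: v_def Z'_def)
      then show ?thesis using Z[of y] that rR by auto
    qed
    have dv: "((\<lambda>t. v (y + t *\<^sub>R axis i 1)) has_real_derivative v1 i y) (at 0)"
      if "y \<in> ball x0 R" for y i
      using DERIV_add[OF DERIV_const DERIV_cmult[OF D_line[OF that, of i "- k"], of B], of A]
      unfolding v_def v1_def by (simp add: algebra_simps)
    have dv1: "((\<lambda>t. v1 i (y + t *\<^sub>R axis i 1)) has_real_derivative v2 i y) (at 0)"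
      if "y \<in> ball x0 R" for y i
    proof -
      have "((\<lambda>t. (y - x0) $ i + t) has_real_derivative 1) (at 0)"
        by (auto intro!: derivative_eq_intros)
      from DERIV_mult[OF DERIV_cmult[OF D_line[OF that, of i "- k - 1"], of "2 * k * B"] this]
      show ?thesis
        unfolding v1_def v2_def
        by (simp add: algebra_simps power2_eq_square)
    qed
    have cont: "continuous_on (ball x0 R) v" "continuous_on (ball x0 R) (v1 i)"
      "continuous_on (ball x0 R) (v2 i)" for i
    proof -
      have "continuous_on (ball x0 R) D" unfolding D_def by (intro continuous_intros)
      moreover have "\<forall>y\<in>ball x0 R. D y \<noteq> 0" using D by (metis less_irrefl)
      ultimately show "continuous_on (ball x0 R) v" "continuous_on (ball x0 R) (v1 i)"
        "continuous_on (ball x0 R) (v2 i)"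
        unfolding v_def v1_def v2_def by (intro continuous_intros; simp)+
    qed
    have vpos: "v y > 0" if "y \<in> ball x0 R" for y
      using A B D_pow[OF that, of "- k"] by (simp add: v_def add_pos_pos)
    obtain x where x: "x \<in> ball x0 R" "(norm (gradient u x))\<^sup>2 > v x" "u x > 0"
      and main: "2 / CARD('n) * (u x powr (2 * p) + M\<^sup>2 * (norm (gradient u x))\<^sup>2 powr q)
      \<le> (\<Sum>i\<in>UNIV. v2 i x) + 2 * p * u x powr (p - 1) * (norm (gradient u x))\<^sup>2
        + M * q * (norm (gradient u x))\<^sup>2 powr (q / 2 - 1) * (gradient u x \<bullet> (\<chi> i. v1 i x))"
      using bernstein_inequality[OF sol Om M r0 rR dv dv1 cont vpos bdry above] by blast
    define z where "z = (norm (gradient u x))\<^sup>2"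
    \<comment> \<open>With this scaling, \<open>w\<close> is the singular part of the barrier at
      \<open>x\<close>, and \<open>w * R\<^sup>2 / (D x)\<^sup>2\<close> equals
      \<open>M\<^sup>2 * w * \<tau>\<^sup>2 / C\<^sup>2\<close>.\<close>
    define \<tau> where "\<tau> = C * R / (M * D x)"
    define w where "w = \<tau> powr k"
    define \<rho> where "\<rho> = norm (x - x0)"
    have Dx: "D x > 0" using D x by simp
    have \<rho>: "0 \<le> \<rho>" "\<rho> \<le> R" using x(1) by (auto simp: \<rho>_def dist_norm norm_minus_commute)
    have \<tau>: "\<tau> > 0" using C(1) M R Dx by (simp add: \<tau>_def)
    have w_pos: "w > 0" using \<tau> by (simp add: w_def)
    have w: "B * D x powr (- k) = w"
    proof -
      have "w = (C * R / M / D x) powr k" by (simp add: w_def \<tau>_def)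
      also have "\<dots> = B / D x powr k"
        unfolding B_def by (rule powr_divide)
      finally show ?thesis using Dx by (simp add: powr_minus divide_inverse)
    qed
    have w1: "B * D x powr (- k - 1) = w / D x"
      using w Dx by (simp add: powr_diff)
    have w2: "B * D x powr (- k - 2) = w / (D x)\<^sup>2"
      using w Dx by (simp add: powr_diff powr_numeral)
    have z: "z > A" "z > w" using x(2) A w_pos w by (auto simp: z_def v_def)
    have z_pos: "z > 0" using z A by simp
    \<comment> \<open>The exponent \<open>k = 2 / (q - 1)\<close> is the one with
      \<open>k * q = k + 2\<close>: two derivatives of the barrier grow like its \<open>q\<close>-th
      power.\<close>
    have wq: "w powr q = w * \<tau>\<^sup>2" "w powr ((q + 1) / 2) = w * \<tau>"
    proof -
      have e1: "k * q = k + 2" and e2: "k * ((q + 1) / 2) = k + 1"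
        using q1 by (simp_all add: k_def field_simps)
      show "w powr q = w * \<tau>\<^sup>2"
        unfolding w_def powr_powr e1 powr_add using \<tau> by (simp add: powr_numeral)
      show "w powr ((q + 1) / 2) = w * \<tau>"
        unfolding w_def powr_powr e2 powr_add using \<tau> by simp
    qed
    \<comment> \<open>The constant part \<open>A\<close> of the barrier acts here:
      \<open>z > A\<close> makes the remainder of the reaction term strictly smaller than
      \<open>M\<^sup>2 * z powr q / n\<close>. This strictness gives the final
      contradiction.\<close>
    have "K / M\<^sup>2 < z powr (q - s)"
    proof -
      have "A powr (q - s) = K / M\<^sup>2" using qs K M by (simp add: A_def powr_powr)
      moreover have "A powr (q - s) < z powr (q - s)" using A z qs by (intro powr_less_mono2) auto
      ultimately show ?thesis by simp
    qed
    then have "K / M\<^sup>2 * z powr s < z powr (q - s) * z powr s"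
      using z_pos by (intro mult_strict_right_mono) auto
    then have "K * z powr s < M\<^sup>2 * z powr q"
      using M by (simp add: field_simps flip: powr_add)
    then have lower: "K / n * z powr s < 1 / n * (M\<^sup>2 * z powr q)"
      using n by (simp add: field_simps)
    have young: "2 * p * u x powr (p - 1) * z \<le> 2 / n * u x powr (2 * p) + K / n * z powr s"
      using reaction_term_young[OF p n x(3), of z] z_pos n by (simp add: K_def s_def)
    have "(\<Sum>i\<in>UNIV. v2 i x) = 2 * k * n * (w / D x) + 4 * k * (k + 1) * \<rho>\<^sup>2 * (w / (D x)\<^sup>2)"
    proof -
      have "(\<Sum>i\<in>UNIV. ((x - x0) $ i)\<^sup>2) = \<rho>\<^sup>2"
        by (simp add: \<rho>_def norm_vec_def L2_set_def sum_nonneg)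
      then have "(\<Sum>i\<in>UNIV. 4 * k * (k + 1) * B * D x powr (- k - 2) * ((x - x0) $ i)\<^sup>2)
          = 4 * k * (k + 1) * (B * D x powr (- k - 2)) * \<rho>\<^sup>2"
        by (simp only: sum_distrib_left[symmetric] mult.assoc)
      moreover have "(\<Sum>i\<in>UNIV. v2 i x) = n * (2 * k * (B * D x powr (- k - 1)))
          + (\<Sum>i\<in>UNIV. 4 * k * (k + 1) * B * D x powr (- k - 2) * ((x - x0) $ i)\<^sup>2)"
        by (simp add: v2_def sum.distrib n_def mult_ac)
      ultimately show ?thesis unfolding w1 w2 by (simp add: mult_ac)
    qed
    \<comment> \<open>The crude bounds \<open>D x \<le> R\<^sup>2\<close> and
      \<open>\<rho> \<le> R\<close> bring both terms to multiples of
      \<open>w * R\<^sup>2 / (D x)\<^sup>2\<close>.\<close>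
    also have "\<dots> \<le> 2 * k * n * (w / (D x)\<^sup>2 * R\<^sup>2) + 4 * k * (k + 1) * R\<^sup>2 * (w / (D x)\<^sup>2)"
    proof (rule add_mono)
      have "w / D x = w / (D x)\<^sup>2 * D x" using Dx by (simp add: power2_eq_square)
      also have "\<dots> \<le> w / (D x)\<^sup>2 * R\<^sup>2"
        using w_pos by (intro mult_left_mono) (auto simp: D_def)
      finally show "2 * k * n * (w / D x) \<le> 2 * k * n * (w / (D x)\<^sup>2 * R\<^sup>2)"
        using k n by (intro mult_left_mono) auto
      show "4 * k * (k + 1) * \<rho>\<^sup>2 * (w / (D x)\<^sup>2) \<le> 4 * k * (k + 1) * R\<^sup>2 * (w / (D x)\<^sup>2)"
        using \<rho> k w_pos by (intro mult_right_mono mult_left_mono power_mono) auto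
    qed
    also have "\<dots> = (2 * k * n + 4 * k * (k + 1)) * (M\<^sup>2 * (w * \<tau>\<^sup>2) / C\<^sup>2)"
      using Dx M C(1) by (simp add: \<tau>_def field_simps)
    also have "\<dots> \<le> C\<^sup>2 / (2 * n) * (M\<^sup>2 * (w * \<tau>\<^sup>2) / C\<^sup>2)"
      using C_sq n w_pos by (intro mult_right_mono) (auto simp: field_simps)
    also have "\<dots> = 1 / (2 * n) * (M\<^sup>2 * w powr q)"
      using C(1) by (simp add: wq)
    also have "\<dots> \<le> 1 / (2 * n) * (M\<^sup>2 * z powr q)"
      using n w_pos z q1 by (intro mult_left_mono powr_mono2) auto
    finally have lap_v: "(\<Sum>i\<in>UNIV. v2 i x) \<le> 1 / (2 * n) * (M\<^sup>2 * z powr q)" .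
    have "(\<chi> i. v1 i x) = (2 * k * (w / D x)) *\<^sub>R (x - x0)"
      unfolding w1[symmetric] by (simp add: v1_def vec_eq_iff mult_ac)
    then have "gradient u x \<bullet> (\<chi> i. v1 i x) \<le> norm (gradient u x) * (2 * k * (w / D x) * \<rho>)"
      using norm_cauchy_schwarz[of "gradient u x" "\<chi> i. v1 i x"] k w_pos Dx by (simp add: \<rho>_def)
    also have "norm (gradient u x) = z powr (1 / 2)"
      by (simp add: z_def powr_half_sqrt)
    also have "z powr (1 / 2) * (2 * k * (w / D x) * \<rho>) \<le> z powr (1 / 2) * (2 * k * (w / D x) * R)"
      using \<rho> k w_pos Dx by (intro mult_left_mono) auto
    also have "2 * k * (w / D x) * R = 2 * k / C * M * (w * \<tau>)"
      using Dx M C(1) by (simp add: \<tau>_def field_simps)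
    also have "w * \<tau> = w powr ((q + 1) / 2)" using wq by simp
    also have "z powr (1 / 2) * (2 * k / C * M * w powr ((q + 1) / 2))
        \<le> z powr (1 / 2) * (2 * k / C * M * z powr ((q + 1) / 2))"
      using k C(1) M w_pos z q1 by (intro mult_left_mono powr_mono2) auto
    finally have "M * q * z powr (q / 2 - 1) * (gradient u x \<bullet> (\<chi> i. v1 i x))
        \<le> M * q * z powr (q / 2 - 1) * (z powr (1 / 2) * (2 * k / C * M * z powr ((q + 1) / 2)))"
      using M q1 by (intro mult_left_mono) auto
    also have "\<dots> = 2 * k * q / C * (M\<^sup>2 * (z powr (q / 2 - 1) * z powr (1 / 2) * z powr ((q + 1) / 2)))"
      by (simp add: power2_eq_square)
    also have "z powr (q / 2 - 1) * z powr (1 / 2) * z powr ((q + 1) / 2) = z powr q"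
      by (simp flip: powr_add) (simp add: field_simps)
    also have "2 * k * q / C * (M\<^sup>2 * z powr q) \<le> 1 / (2 * n) * (M\<^sup>2 * z powr q)"
      using C(1,2) n by (intro mult_right_mono) (auto simp: field_simps)
    finally have grad_v: "M * q * z powr (q / 2 - 1) * (gradient u x \<bullet> (\<chi> i. v1 i x))
        \<le> 1 / (2 * n) * (M\<^sup>2 * z powr q)" .
    have "2 / n * u x powr (2 * p) + 2 / n * (M\<^sup>2 * z powr q)
      \<le> (\<Sum>i\<in>UNIV. v2 i x) + 2 * p * u x powr (p - 1) * z
        + M * q * z powr (q / 2 - 1) * (gradient u x \<bullet> (\<chi> i. v1 i x))"
      using main unfolding z_def[symmetric] n_def[symmetric] by (simp add: distrib_left)
    \<comment> \<open>The three shares pay for the reaction term, the Laplacian of \<open>v\<close>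
      and the gradient term, respectively.\<close>
    moreover have "2 / n * (M\<^sup>2 * z powr q) = 1 / n * (M\<^sup>2 * z powr q)
      + 1 / (2 * n) * (M\<^sup>2 * z powr q) + 1 / (2 * n) * (M\<^sup>2 * z powr q)"
      using n by (simp add: field_simps)
    ultimately show False using lap_v grad_v young lower by linarith
  qed
  then show ?thesis
    using K C(1) by (intro exI[of _ K] exI[of _ C] conjI) (auto simp: s_def k_def)
qed

section \<open>From balls to domains and ground states\<close>

text \<open>Balls are connected: one that meets \<open>S\<close> without being contained in it hits
  the frontier, at distance at most \<open>R\<close> from \<open>x\<close>.\<close>

lemma cball_subset_of_infdist_frontier:
  fixes x :: "'a :: real_normed_vector"
  assumes "open S" "x \<in> S" "frontier S \<noteq> {}" "0 \<le> R" "R < infdist x (frontier S)"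
  shows "cball x R \<subseteq> S"
proof (rule ccontr)
  assume "\<not> cball x R \<subseteq> S"
  then have "cball x R \<inter> frontier S \<noteq> {}"
  proof (intro connected_Int_frontier)
    have "x \<in> cball x R \<inter> S" using assms by simp
    then show "cball x R \<inter> S \<noteq> {}" by blast
  qed auto
  then obtain y where "y \<in> frontier S" "dist x y \<le> R" by auto
  then show False using infdist_le[of y "frontier S" x] assms by auto
qed

text \<open>The gradient bound makes \<open>u\<close> Lipschitz with constant \<open>L\<close>; the
  value \<open>u 0\<close> is absorbed into the linear term once
  \<open>norm x \<ge> 1\<close>.\<close>

lemma bounded_gradient_imp_linear_growth:
  fixes u :: "real ^ 'n \<Rightarrow> real"
  assumes "\<And>x. u differentiable (at x)" and L: "\<And>x. norm (gradient u x) \<le> L"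
  shows "u \<in> O[at_infinity](\<lambda>x. norm x)"
proof (rule bigoI)
  have lip: "norm (u x - u 0) \<le> L * norm (x - 0)" for x
  proof (rule differentiable_bound[of UNIV u "\<lambda>x. frechet_derivative u (at x)" L])
    show "(u has_derivative frechet_derivative u (at y)) (at y within UNIV)" for y
      using assms(1) frechet_derivative_works by blast
    show "onorm (frechet_derivative u (at y)) \<le> L" for y
    proof (rule onorm_le)
      fix h
      have "norm (frechet_derivative u (at y) h) \<le> norm (gradient u y) * norm h"
        using frechet_derivative_eq_gradient[OF assms(1)] Cauchy_Schwarz_ineq2 by auto
      also have "\<dots> \<le> L * norm h" using L by (simp add: mult_right_mono)
      finally show "norm (frechet_derivative u (at y) h) \<le> L * norm h" .
    qed
  qed auto
  have "norm (u x) \<le> (\<bar>u 0\<bar> + L) * norm (norm x)" if "norm x \<ge> 1" for x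
  proof -
    have "\<bar>u 0\<bar> * 1 \<le> \<bar>u 0\<bar> * norm x" using that by (intro mult_left_mono) auto
    then show ?thesis using lip[of x] by (simp add: distrib_right)
  qed
  then show "\<forall>\<^sub>F x in at_infinity. norm (u x) \<le> (\<bar>u 0\<bar> + L) * norm (norm x)"
    unfolding eventually_at_infinity by blast
qed

theorem theoremA:
  fixes p q :: real
  assumes "p > 1" and "q > 2 * p / (p + 1)"
  shows "\<exists>c>0. \<forall>M>0.
    (\<forall>(\<Omega> :: (real ^ 'n) set) u.
       is_domain \<Omega> \<and> frontier \<Omega> \<noteq> {} \<and> positive_solution p q M \<Omega> u \<longrightarrow>
       (\<forall>x\<in>\<Omega>. norm (gradient u x) \<le>
          c * (M powr (- ((p + 1) / ((p + 1) * q - 2 * p)))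
               + (M * infdist x (frontier \<Omega>)) powr (- (1 / (q - 1)))))) \<and>
    (\<forall>u :: real ^ 'n \<Rightarrow> real.
       ground_state p q M u \<longrightarrow>
       (\<forall>x. norm (gradient u x) \<le> c * M powr (- ((p + 1) / ((p + 1) * q - 2 * p)))) \<and>
       u \<in> O[at_infinity](\<lambda>x. norm x))"
proof -
  define \<alpha> where "\<alpha> = (p + 1) / ((p + 1) * q - 2 * p)"
  define \<beta> where "\<beta> = 1 / (q - 1)"
  have "2 * p / (p + 1) > 1" using assms(1) by (simp add: field_simps)
  then have \<beta>: "\<beta> > 0" using assms(2) by (simp add: \<beta>_def)
  have \<alpha>: "1 / (q - 2 * p / (p + 1)) = \<alpha>" using assms(1) by (simp add: \<alpha>_def field_simps)
  obtain K C where K: "K > 0" and C: "C > 0" and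
    est: "\<forall>M>0. \<forall>R>0. \<forall>\<Omega> (u :: real ^ 'n \<Rightarrow> real) x0.
      positive_solution p q M \<Omega> u \<and> open \<Omega> \<and> cball x0 R \<subseteq> \<Omega> \<longrightarrow>
      (norm (gradient u x0))\<^sup>2 \<le> (K / M\<^sup>2) powr \<alpha> + (C / (M * R)) powr (2 / (q - 1))"
    using gradient_estimate_ball[OF assms, where 'n = 'n] unfolding \<alpha>
    by - (elim exE conjE, rule that; assumption)
  define c where "c = max (K powr (\<alpha> / 2)) ((2 * C) powr \<beta>)"
  have c: "c > 0" using K by (simp add: c_def less_max_iff_disj)
  \<comment> \<open>Written in terms of \<open>2 * R\<close>, with the factor 2 moved into
    \<open>c\<close>, because the ball used in a domain has half the distance to the frontier as its
    radius.\<close>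
  have bound: "norm (gradient u x) \<le> c * (M powr (- \<alpha>) + (M * (2 * R)) powr (- \<beta>))"
    if "M > 0" "R > 0" "positive_solution p q M \<Omega> u" "open \<Omega>" "cball x R \<subseteq> \<Omega>"
    for M R \<Omega> x and u :: "real ^ 'n \<Rightarrow> real"
  proof -
    have "norm (gradient u x) \<le> sqrt ((K / M\<^sup>2) powr \<alpha> + (C / (M * R)) powr (2 / (q - 1)))"
      using est that by (intro real_le_rsqrt) simp
    also have "\<dots> \<le> sqrt ((K / M\<^sup>2) powr \<alpha>) + sqrt ((C / (M * R)) powr (2 / (q - 1)))"
      by (intro sqrt_add_le_add_sqrt) auto
    also have "sqrt ((K / M\<^sup>2) powr \<alpha>) = K powr (\<alpha> / 2) * M powr (- \<alpha>)"
    proof -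
      have "sqrt ((K / M\<^sup>2) powr \<alpha>) = (K / M powr 2) powr (\<alpha> / 2)"
        using that(1) K by (simp add: powr_half_sqrt_powr)
      also have "\<dots> = K powr (\<alpha> / 2) / (M powr 2) powr (\<alpha> / 2)"
        by (rule powr_divide)
      also have "(M powr 2) powr (\<alpha> / 2) = M powr \<alpha>" unfolding powr_powr by simp
      finally show ?thesis by (simp only: powr_minus divide_inverse)
    qed
    also have "sqrt ((C / (M * R)) powr (2 / (q - 1))) = (2 * C) powr \<beta> * (M * (2 * R)) powr (- \<beta>)"
    proof -
      have "sqrt ((C / (M * R)) powr (2 / (q - 1))) = (C / (M * R)) powr \<beta>"
      proof -
        have "2 / (q - 1) = 2 * \<beta>" by (simp add: \<beta>_def)
        then show ?thesis using powr_half_sqrt_powr[of "C / (M * R)" "2 * \<beta>"] C that by simp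
      qed
      also have "\<dots> = (2 * C / (M * (2 * R))) powr \<beta>" using that by simp
      also have "\<dots> = (2 * C) powr \<beta> / (M * (2 * R)) powr \<beta>"
        by (rule powr_divide)
      finally show ?thesis by (simp only: powr_minus divide_inverse)
    qed
    also have "K powr (\<alpha> / 2) * M powr (- \<alpha>) + (2 * C) powr \<beta> * (M * (2 * R)) powr (- \<beta>)
        \<le> c * M powr (- \<alpha>) + c * (M * (2 * R)) powr (- \<beta>)"
      by (intro add_mono mult_right_mono) (auto simp: c_def)
    finally show ?thesis by (simp add: distrib_left)
  qed
  have domain_bound: "norm (gradient u x) \<le> c * (M powr (- \<alpha>) + (M * infdist x (frontier \<Omega>)) powr (- \<beta>))"
    if M: "M > 0" and dom: "is_domain \<Omega>" "frontier \<Omega> \<noteq> {}" and sol: "positive_solution p q M \<Omega> u"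
      and x: "x \<in> \<Omega>" for M \<Omega> x and u :: "real ^ 'n \<Rightarrow> real"
  proof -
    have "open \<Omega>" using dom by (simp add: is_domain_def)
    then have "x \<notin> frontier \<Omega>" using x by (simp add: frontier_def interior_open)
    \<comment> \<open>Positivity matters: at distance 0 the convention \<open>0 powr a = 0\<close>
      would erase the distance term instead of making it infinite.\<close>
    then have d: "infdist x (frontier \<Omega>) > 0"
      using infdist_pos_not_in_closed[OF frontier_closed dom(2)] by simp
    have "cball x (infdist x (frontier \<Omega>) / 2) \<subseteq> \<Omega>"
      using d by (intro cball_subset_of_infdist_frontier \<open>open \<Omega>\<close> x dom(2)) auto
    from bound[OF M _ sol \<open>open \<Omega>\<close> this] d show ?thesis by simp
  qed
  have global_bound: "norm (gradient u x) \<le> c * M powr (- \<alpha>)"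
    if M: "M > 0" and sol: "ground_state p q M u" for M x and u :: "real ^ 'n \<Rightarrow> real"
  \<comment> \<open>In the whole space every radius is admissible, and the distance term vanishes as
    \<open>R\<close> tends to infinity.\<close>
  proof (rule tendsto_lowerbound)
    have "filterlim (\<lambda>R. M * 2 * R) at_top at_top"
      using M by (intro filterlim_tendsto_pos_mult_at_top[OF tendsto_const] filterlim_ident) auto
    then have "((\<lambda>R. (M * 2 * R) powr (- \<beta>)) \<longlongrightarrow> 0) at_top"
      using \<beta> by (intro tendsto_neg_powr) auto
    then have "((\<lambda>R. c * (M powr (- \<alpha>) + (M * 2 * R) powr (- \<beta>))) \<longlongrightarrow> c * (M powr (- \<alpha>) + 0)) at_top"
      by (intro tendsto_intros)
    then show "((\<lambda>R. c * (M powr (- \<alpha>) + (M * (2 * R)) powr (- \<beta>))) \<longlongrightarrow> c * M powr (- \<alpha>)) at_top"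
      by (simp add: mult.assoc)
    show "\<forall>\<^sub>F R in at_top. norm (gradient u x) \<le> c * (M powr (- \<alpha>) + (M * (2 * R)) powr (- \<beta>))"
      using eventually_gt_at_top[of 0]
      by eventually_elim (rule bound[OF M _ sol[unfolded ground_state_def]]; simp)
  qed simp
  have growth: "u \<in> O[at_infinity](\<lambda>x. norm x)" if "M > 0" "ground_state p q M u"
    for M and u :: "real ^ 'n \<Rightarrow> real"
  proof (rule bounded_gradient_imp_linear_growth)
    show "u differentiable (at x)" for x
      using that(2) C2_onD(1)[of UNIV u] by (simp add: ground_state_def positive_solution_def)
    show "norm (gradient u x) \<le> c * M powr (- \<alpha>)" for x by (rule global_bound[OF that])
  qed
  show ?thesis
    unfolding \<alpha>_def[symmetric] \<beta>_def[symmetric]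
  proof (intro exI[of _ c] conjI allI impI ballI)
    show "c > 0" by (rule c)
  qed (use domain_bound global_bound growth in \<open>simp_all\<close>)
qed

end
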